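(* Let $C$ be a quaternary Hermitian LCD $[n,k]$ code and let $G$ be a generator matrix of $C$ such that $G\overline{G}^T=I_k$. Let $l_i$ denote the $i$-th column of $G$. Then the punctured code $C^i$ is a Hermitian LCD code if and only if $\mathrm{wt}(l_i)$ is even.
   Context: A quaternary $[n,k]$ code is a $k$-dimensional subspace $C$ of $\mathbb{F}_4^n$; a generator matrix of it is a matrix whose rows form a basis of it. Here $i$ is a coordinate position, $1\le i\le n$. The weight $\mathrm{wt}(v)$ of a vector $v$ is its number of nonzero coordinates. For $a\in\mathbb{F}_4$, $\overline{a}=a^2$; for a matrix $M$, $\overline{M}$ is the entrywise conjugate and $M^T$ the transpose. $I_k$ is the identity matrix of order $k$. The Hermitian inner product of $u,v\in\mathbb{F}_4^m$ is $(u,v)_h=\sum_{j=1}^m u_j\overline{v_j}$, and for a code $C$ of length $m$, $C^{\perp h}=\{u\in\mathbb{F}_4^m\mid (u,v)_h=0\text{ for all }v\in C\}$. A code $C$ is a Hermitian LCD code if $C\cap C^{\perp h}=\{0\}$. The punctured code $C^i$ is the code of length $n-1$ obtained by deleting the $i$-th coordinate from every codeword of $C$.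
   Formalization: The formal theorem additionally assumes that C does not contain the i-th unit vector; without this the claim is false (C = F_4^2, G = I_2: the column weight is 1, yet the punctured code is Hermitian LCD), and it fails whenever the i-th unit vector lies in C. *)

theory Defs
  imports "Jordan_Normal_Form.VS_Connect" "HOL-Library.Cardinality"
begin

text \<open>
  A vector of length \<open>n\<close> is an element of \<open>carrier_vec n\<close>, and a code is a set of such vectors.
  Coordinate positions are numbered from \<open>0\<close>, so position \<open>i\<close> of a code of length \<open>n\<close> satisfies
  \<open>i < n\<close>. The definitions make sense over any field \<open>'a\<close>; the field is \<open>\<bbbF>\<^sub>4\<close> exactly when
  \<open>CARD('a) = 4\<close>.

  The notions below do not bound the minimum distance: if the unit vector \<open>unit_vec n i\<close> lies in
  the code, puncturing at \<open>i\<close> lowers the dimension by one, and length \<open>0\<close> is allowed. For example,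
  \<open>\<bbbF>\<^sub>4\<^sup>2\<close> is Hermitian LCD with generator matrix \<open>1\<^sub>m 2\<close> and its puncturings \<open>\<bbbF>\<^sub>4\<close> are Hermitian
  LCD, although the columns of \<open>1\<^sub>m 2\<close> have weight \<open>1\<close>. Statements that relate a punctured code to
  a generator matrix therefore need \<open>unit_vec n i \<notin> C\<close>.
\<close>

abbreviation code_vs :: "nat \<Rightarrow> 'a::field vec set \<Rightarrow> ('a, 'a vec) module" where
  "code_vs n C \<equiv> (module_vec TYPE('a) n)\<lparr>carrier := C\<rparr>"

definition linear_code :: "nat \<Rightarrow> nat \<Rightarrow> 'a::field vec set \<Rightarrow> bool" where
  "linear_code n k C \<longleftrightarrow>
     VectorSpace.subspace class_ring C (module_vec TYPE('a) n) \<and>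
     vectorspace.dim class_ring (code_vs n C) = k"

definition generator_matrix :: "nat \<Rightarrow> nat \<Rightarrow> 'a::field vec set \<Rightarrow> 'a mat \<Rightarrow> bool" where
  "generator_matrix n k C G \<longleftrightarrow>
     G \<in> carrier_mat k n \<and> distinct (rows G) \<and>
     vectorspace.basis class_ring (code_vs n C) (set (rows G))"

definition conj4 :: "'a::field \<Rightarrow> 'a" where
  "conj4 a = a\<^sup>2"

definition herm_prod :: "'a::field vec \<Rightarrow> 'a vec \<Rightarrow> 'a" where
  "herm_prod u v = u \<bullet> map_vec conj4 v"

definition herm_dual :: "nat \<Rightarrow> 'a::field vec set \<Rightarrow> 'a vec set" where
  "herm_dual m C = {u \<in> carrier_vec m. \<forall>v\<in>C. herm_prod u v = 0}"

definition hermitian_LCD :: "nat \<Rightarrow> 'a::field vec set \<Rightarrow> bool" where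
  "hermitian_LCD m C \<longleftrightarrow> C \<inter> herm_dual m C = {0\<^sub>v m}"

definition wt :: "'a::zero vec \<Rightarrow> nat" where
  "wt v = card {j. j < dim_vec v \<and> v $ j \<noteq> 0}"

definition delete_coord :: "nat \<Rightarrow> 'a vec \<Rightarrow> 'a vec" where
  "delete_coord i v = vec (dim_vec v - 1) (\<lambda>j. v $ (if j < i then j else Suc j))"

definition puncture :: "nat \<Rightarrow> 'a vec set \<Rightarrow> 'a vec set" where
  "puncture i C = delete_coord i ` C"

end

theory Submission
  imports Defs
begin

text \<open>
  Let \<open>l\<close> be the \<open>i\<close>-th column of \<open>G\<close>. The codeword \<open>w = \<Sum>\<^sub>r conj (l\<^sub>r) row\<^sub>r(G)\<close> is the Hermitian
  projection of \<open>unit_vec n i\<close> onto \<open>C\<close>: it satisfies \<open>(v, w)\<^sub>h = v\<^sub>i\<close> for all \<open>v \<in> C\<close>, and its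
  \<open>i\<close>-th coordinate is the image of \<open>wt l\<close> in the field. Deleting coordinate \<open>i\<close> subtracts
  \<open>u\<^sub>i conj (v\<^sub>i)\<close> from \<open>(u, v)\<^sub>h\<close>. If \<open>w\<^sub>i = 0\<close>, testing a vector of the hull of the punctured code
  against the punctured \<open>w\<close> shows that it comes from the hull of \<open>C\<close>. If \<open>w\<^sub>i = 1\<close>, the punctured
  \<open>w\<close> lies in the hull, and it is nonzero since otherwise \<open>w = unit_vec n i\<close>.
\<close>

text \<open>Multiplication by \<open>x\<close> permutes the three nonzero elements, so their product
  equals \<open>x ^ 3\<close> times itself and can be cancelled.\<close>

lemma field_4_power3:
  fixes x :: "'a::field"
  assumes "CARD('a) = 4" "x \<noteq> 0"
  shows "x ^ 3 = 1"
proof -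
  have fin: "finite (UNIV :: 'a set)"
    using assms(1) card.infinite by fastforce
  let ?U = "UNIV - {0 :: 'a}"
  have "card ?U = 3"
    using fin assms(1) by (simp add: card_Diff_singleton)
  have "bij_betw ((*) x) ?U ?U"
    using assms(2) by (intro bij_betw_byWitness[where f' = "(*) (inverse x)"]) auto
  then have "(\<Prod>y\<in>?U. x * y) = \<Prod>?U"
    by (rule prod.reindex_bij_betw)
  then have "x ^ 3 * \<Prod>?U = \<Prod>?U"
    using \<open>card ?U = 3\<close> by (simp add: prod.distrib)
  moreover have "\<Prod>?U \<noteq> 0"
    using fin by simp
  ultimately show ?thesis
    by simp
qed

text \<open>Translation by 1 permutes the field, so adding up all elements gives 4 = 0; this is 2 *
  2 = 0, and a field has no zero divisors.\<close>

lemma field_4_char_2: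
  assumes "CARD('a::field) = 4"
  shows "(2 :: 'a) = 0"
proof -
  have "bij ((+) (1 :: 'a))"
    by (intro bij_betw_byWitness[where f' = "(+) (-1)"]) auto
  then have "(\<Sum>y\<in>UNIV. 1 + y) = \<Sum>(UNIV :: 'a set)"
    by (rule sum.reindex_bij_betw)
  then have "(2 :: 'a) * 2 = 0"
    using assms by (simp add: sum.distrib)
  then show ?thesis
    unfolding mult_eq_0_iff by blast
qed

lemma conj4_zero [simp]: "conj4 (0 :: 'a::field) = 0"
  by (simp add: conj4_def)

lemma conj4_mult: "conj4 (x * y) = conj4 x * conj4 (y :: 'a::field)"
  by (simp add: conj4_def power_mult_distrib)

lemma conj4_add:
  fixes x y :: "'a::field"
  assumes "CARD('a) = 4"
  shows "conj4 (x + y) = conj4 x + conj4 y"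
  using field_4_char_2[OF assms] by (simp add: conj4_def power2_sum)

lemma conj4_sum:
  fixes f :: "'b \<Rightarrow> 'a::field"
  assumes "CARD('a) = 4"
  shows "conj4 (sum f A) = (\<Sum>x\<in>A. conj4 (f x))"
  by (induction A rule: infinite_finite_induct) (simp_all add: conj4_add[OF assms])

text \<open>The product is the cube of \<open>x\<close>. Each nonzero coordinate thus contributes
  exactly 1 to a Hermitian norm, which is how weights enter.\<close>

lemma conj4_mult_self:
  fixes x :: "'a::field"
  assumes "CARD('a) = 4"
  shows "conj4 x * x = of_bool (x \<noteq> 0)"
  using field_4_power3[OF assms, of x]
  by (auto simp: conj4_def power3_eq_cube power2_eq_square)

lemma conj4_conj4:
  fixes x :: "'a::field"
  assumes "CARD('a) = 4"
  shows "conj4 (conj4 x) = x"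
  using conj4_mult_self[OF assms, of x]
  by (cases "x = 0") (auto simp: conj4_def power2_eq_square mult.assoc)

lemma map_vec_conj4_mult_mat_vec:
  fixes A :: "'a::field mat"
  assumes "CARD('a) = 4" "A \<in> carrier_mat m n" "v \<in> carrier_vec n"
  shows "map_vec conj4 (A *\<^sub>v v) = map_mat conj4 A *\<^sub>v map_vec conj4 v"
  using assms(2,3)
  by (intro eq_vecI) (auto simp: scalar_prod_def conj4_sum[OF assms(1)] conj4_mult)

lemma of_nat_eq_of_bool_odd:
  assumes "(2 :: 'a::semiring_1) = 0"
  shows "(of_nat m :: 'a) = of_bool (odd m)"
proof (cases "even m")
  case True
  then obtain k where "m = 2 * k" by blast
  then show ?thesis using assms by simp
next
  case False
  then obtain k where "m = 2 * k + 1" using oddE by blast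
  then show ?thesis using assms by simp
qed

lemma scalar_prod_conj4_self:
  fixes v :: "'a::field vec"
  assumes "CARD('a) = 4"
  shows "v \<bullet> map_vec conj4 v = of_bool (odd (wt v))"
proof -
  have "v \<bullet> map_vec conj4 v = (\<Sum>j<dim_vec v. of_bool (v $ j \<noteq> 0))"
    by (simp add: scalar_prod_def conj4_mult_self[OF assms] mult.commute[of "v $ _"]
        lessThan_atLeast0)
  also have "\<dots> = of_nat (wt v)"
    by (simp add: wt_def of_bool_def sum.If_cases Int_def)
  finally show ?thesis
    by (simp add: of_nat_eq_of_bool_odd[OF field_4_char_2[OF assms]])
qed

lemma herm_prod_conj_commute:
  fixes u v :: "'a::field vec"
  assumes "CARD('a) = 4" "u \<in> carrier_vec n" "v \<in> carrier_vec n"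
  shows "herm_prod u v = conj4 (herm_prod v u)"
proof -
  have "conj4 (herm_prod v u) = (\<Sum>j\<in>{0..<n}. conj4 (v $ j * conj4 (u $ j)))"
    using assms(2,3) by (simp add: herm_prod_def scalar_prod_def conj4_sum[OF assms(1)])
  also have "\<dots> = (\<Sum>j\<in>{0..<n}. u $ j * conj4 (v $ j))"
    by (simp only: conj4_mult conj4_conj4[OF assms(1)] mult.commute)
  also have "\<dots> = herm_prod u v"
    using assms(2,3) by (simp add: herm_prod_def scalar_prod_def)
  finally show ?thesis by simp
qed

lemma delete_coord_carrier:
  "v \<in> carrier_vec n \<Longrightarrow> delete_coord i v \<in> carrier_vec (n - 1)"
  by (auto simp: delete_coord_def)

text \<open>Rephrasing the index shift through \<open>insert_index\<close> makes its known image and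
  injectivity available for reindexing sums.\<close>

lemma delete_coord_index:
  assumes "v \<in> carrier_vec n" "j < n - 1"
  shows "delete_coord i v $ j = v $ insert_index i j"
  using assms by (auto simp: delete_coord_def insert_index_def)

lemma herm_prod_delete_coord:
  assumes "u \<in> carrier_vec n" "v \<in> carrier_vec n" "i < n"
  shows "herm_prod u v =
    u $ i * conj4 (v $ i) + herm_prod (delete_coord i u) (delete_coord i v)"
proof -
  obtain m where n: "n = Suc m"
    using assms(3) by (cases n) auto
  let ?f = "\<lambda>j. u $ j * conj4 (v $ j)"
  have "herm_prod u v = sum ?f {0..<Suc m}"
    using assms n by (auto simp: herm_prod_def scalar_prod_def intro!: sum.cong)
  also have "\<dots> = ?f i + sum ?f ({0..<Suc m} - {i})"
    using assms(3) n by (intro sum.remove) auto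
  \<comment> \<open>\<open>insert_index i\<close> enumerates the positions other than
    \<open>i\<close> without repetition.\<close>
  also have "sum ?f ({0..<Suc m} - {i}) = (\<Sum>j\<in>{0..<m}. ?f (insert_index i j))"
    using assms(3) n
    by (simp add: insert_index_image[symmetric] sum.reindex[OF insert_index_inj_on])
  also have "\<dots> = herm_prod (delete_coord i u) (delete_coord i v)"
    using assms n delete_coord_carrier[of u n i] delete_coord_carrier[of v n i]
    by (auto simp: herm_prod_def scalar_prod_def delete_coord_index intro!: sum.cong)
  finally show ?thesis .
qed

lemma delete_coord_eq_0D:
  fixes v :: "'a::semiring_1 vec"
  assumes "v \<in> carrier_vec n" "i < n" "delete_coord i v = 0\<^sub>v (n - 1)"
  shows "v = v $ i \<cdot>\<^sub>v unit_vec n i"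
proof (rule eq_vecI)
  fix j assume "j < dim_vec (v $ i \<cdot>\<^sub>v unit_vec n i)"
  then have j: "j < n" by simp
  obtain m where n: "n = Suc m"
    using assms(2) by (cases n) auto
  show "v $ j = (v $ i \<cdot>\<^sub>v unit_vec n i) $ j"
  proof (cases "j = i")
    case False
    then have "j \<in> insert_index i ` {0..<m}"
      using j n assms(2) by (subst insert_index_image) auto
    then obtain j' where "j' < m" "j = insert_index i j'" by auto
    then have "v $ j = 0"
      using delete_coord_index[OF assms(1), of j' i] assms(3) n by simp
    then show ?thesis using False j assms(2) by simp
  qed (use assms in simp)
qed (use assms in simp)

text \<open>This passes from an abstract basis to matrix algebra, where every codeword has a
  coefficient vector \<open>y\<close>.\<close>

lemma generator_matrix_row_span:
  fixes C :: "'a::field vec set"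
  assumes "linear_code n k C" "generator_matrix n k C G"
  shows "C = {transpose_mat G *\<^sub>v y |y. y \<in> carrier_vec k}"
proof -
  interpret vec_space "TYPE('a)" n .
  have G: "G \<in> carrier_mat k n"
    and basis: "vectorspace.basis class_ring (code_vs n C) (set (rows G))"
    using assms(2) by (auto simp: generator_matrix_def)
  have sub: "VectorSpace.subspace class_ring C V"
    using assms(1) by (simp add: linear_code_def)
  then have vs: "vectorspace class_ring (code_vs n C)"
    by (rule subspace_is_vs)
  have "LinearCombinations.module.span class_ring (code_vs n C) (set (rows G)) = C"
    and rows: "set (rows G) \<subseteq> C"
    using basis by (simp_all add: vectorspace.basis_def[OF vs])
  \<comment> \<open>The basis property speaks of the span inside the module with carrier
    \<open>C\<close>; since the rows lie in the subspace \<open>C\<close>, it agrees with the span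
    in the whole space.\<close>
  then have "C = row_space G"
    using span_li_not_depend(1)[OF rows subspace.submod[OF sub]] by (simp add: row_space_def)
  then show ?thesis
    using G by (auto simp: row_space_eq[OF G])
qed

text \<open>With orthonormal rows, the Hermitian product of a codeword with coefficients
  \<open>y\<close> and \<open>w\<close> collapses to \<open>y \<bullet> col G i\<close>, which is
  coordinate \<open>i\<close> of that codeword.\<close>

lemma hermitian_projection_of_unit_vec:
  fixes C :: "'a::field vec set"
  assumes card: "CARD('a) = 4"
    and code: "linear_code n k C" and gen: "generator_matrix n k C G"
    and orth: "G * transpose_mat (map_mat conj4 G) = 1\<^sub>m k"
    and i: "i < n"
  obtains w where "w \<in> C" "\<And>v. v \<in> C \<Longrightarrow> herm_prod v w = v $ i"
    "w $ i = of_bool (odd (wt (col G i)))"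
proof
  have G: "G \<in> carrier_mat k n"
    using gen by (simp add: generator_matrix_def)
  note C = generator_matrix_row_span[OF code gen]
  let ?l = "col G i"
  let ?H = "transpose_mat (map_mat conj4 G)"
  let ?w = "transpose_mat G *\<^sub>v map_vec conj4 ?l"
  have l: "?l \<in> carrier_vec k" using G by auto
  show "?w \<in> C" unfolding C using l by auto
  have index: "(transpose_mat G *\<^sub>v y) $ i = ?l \<bullet> y" if "y \<in> carrier_vec k" for y
    using G i that by simp
  show "?w $ i = of_bool (odd (wt ?l))"
    using index l by (simp add: scalar_prod_conj4_self[OF card])
  have conj_w: "map_vec conj4 ?w = ?H *\<^sub>v ?l"
  proof -
    have "map_vec conj4 ?w = map_mat conj4 (transpose_mat G) *\<^sub>v map_vec conj4 (map_vec conj4 ?l)"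
      using G l by (intro map_vec_conj4_mult_mat_vec[OF card]) auto
    also have "map_vec conj4 (map_vec conj4 ?l) = ?l"
      by (intro eq_vecI) (auto simp: conj4_conj4[OF card])
    also have "map_mat conj4 (transpose_mat G) = ?H"
      by (intro eq_matI) auto
    finally show ?thesis .
  qed
  fix v assume "v \<in> C"
  then obtain y where y: "y \<in> carrier_vec k" "v = transpose_mat G *\<^sub>v y"
    unfolding C by auto
  have H: "?H \<in> carrier_mat n k" using G by auto
  have "herm_prod v ?w = y \<bullet> (G *\<^sub>v (?H *\<^sub>v ?l))"
    unfolding herm_prod_def conj_w y(2)
    using G y l by (intro transpose_vec_mult_scalar[OF G]) auto
  also have "G *\<^sub>v (?H *\<^sub>v ?l) = ?l"
    using assoc_mult_mat_vec[OF G H l] orth l by simp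
  finally show "herm_prod v ?w = v $ i"
    using index y l comm_scalar_prod by simp
qed

theorem theorem4p4:
  fixes C :: "'a::field vec set" and G :: "'a mat" and n k i :: nat
  assumes "CARD('a) = 4"
    and "linear_code n k C"
    and "hermitian_LCD n C"
    and "generator_matrix n k C G"
    and "G * transpose_mat (map_mat conj4 G) = 1\<^sub>m k"
    and "i < n"
    and "unit_vec n i \<notin> C"
  shows "hermitian_LCD (n - 1) (puncture i C) \<longleftrightarrow> even (wt (col G i))"
proof -
  obtain w where w: "w \<in> C" and proj: "\<And>v. v \<in> C \<Longrightarrow> herm_prod v w = v $ i"
    and wi: "w $ i = of_bool (odd (wt (col G i)))"
    using hermitian_projection_of_unit_vec[OF assms(1,2,4,5,6)] by metis
  have "G \<in> carrier_mat k n"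
    using assms(4) by (simp add: generator_matrix_def)
  then have C: "C \<subseteq> carrier_vec n"
    using generator_matrix_row_span[OF assms(2,4)] by auto
  have hull: "C \<inter> herm_dual n C = {0\<^sub>v n}"
    using assms(3) by (simp add: hermitian_LCD_def)
  have prod: "herm_prod u v =
      u $ i * conj4 (v $ i) + herm_prod (delete_coord i u) (delete_coord i v)"
    if "u \<in> C" "v \<in> C" for u v
    using that C assms(6) by (intro herm_prod_delete_coord) auto
  \<comment> \<open>Orthogonality after puncturing becomes an identity between codewords of
    \<open>C\<close>, because only the term at \<open>i\<close> is lost.\<close>
  have in_dual: "delete_coord i u \<in> herm_dual (n - 1) (puncture i C) \<longleftrightarrow>
      (\<forall>v\<in>C. herm_prod u v = u $ i * conj4 (v $ i))" if "u \<in> C" for u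
  proof -
    have "delete_coord i u \<in> carrier_vec (n - 1)"
      using that C by (intro delete_coord_carrier) auto
    then show ?thesis
      using prod[OF that] by (auto simp: herm_dual_def puncture_def)
  qed
  have zero: "0\<^sub>v n \<in> C" "delete_coord i (0\<^sub>v n :: 'a vec) = 0\<^sub>v (n - 1)"
    using hull assms(6) by (auto simp: delete_coord_def)
  show ?thesis
  proof
    assume even: "even (wt (col G i))"
    have "delete_coord i u = 0\<^sub>v (n - 1)"
      if u: "u \<in> C" and dual: "delete_coord i u \<in> herm_dual (n - 1) (puncture i C)" for u
    proof -
      have *: "herm_prod u v = u $ i * conj4 (v $ i)" if "v \<in> C" for v
        using in_dual[OF u] dual that by blast
      \<comment> \<open>At \<open>v = w\<close> the left side of the identity is
        \<open>u $ i\<close>, while the right side vanishes because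
        \<open>w $ i = 0\<close>.\<close>
      have "u $ i = 0"
        using *[OF w] proj[OF u] wi even by simp
      then have "u \<in> C \<inter> herm_dual n C"
        using * u C by (auto simp: herm_dual_def)
      then show ?thesis
        using hull zero(2) by simp
    qed
    moreover have "delete_coord i (0\<^sub>v n) \<in> herm_dual (n - 1) (puncture i C)"
      using hull zero(1) assms(6) by (subst in_dual) (auto simp: herm_dual_def)
    moreover have "0\<^sub>v (n - 1) \<in> puncture i C"
      unfolding puncture_def zero(2)[symmetric] using zero(1) by (rule imageI)
    ultimately show "hermitian_LCD (n - 1) (puncture i C)"
      unfolding hermitian_LCD_def zero(2) by (subst set_eq_iff) (auto simp: puncture_def)
  next
    assume lcd: "hermitian_LCD (n - 1) (puncture i C)"
    show "even (wt (col G i))"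
    proof (rule ccontr)
      assume "odd (wt (col G i))"
      then have wi1: "w $ i = 1" using wi by simp
      \<comment> \<open>The projection property has \<open>w\<close> in the second argument; duality
        needs it in the first. As \<open>w $ i = 1\<close>, the result is exactly the criterion
        \<open>in_dual\<close> for \<open>w\<close>.\<close>
      have "herm_prod w v = conj4 (v $ i)" if v: "v \<in> C" for v
      proof -
        have "herm_prod w v = conj4 (herm_prod v w)"
          using v w C by (intro herm_prod_conj_commute[OF assms(1)]) auto
        then show ?thesis using proj[OF v] by simp
      qed
      then have "delete_coord i w \<in> herm_dual (n - 1) (puncture i C)"
        using in_dual[OF w] wi1 by simp
      then have "delete_coord i w = 0\<^sub>v (n - 1)"
        using lcd w by (auto simp: hermitian_LCD_def puncture_def)
      then have "w = w $ i \<cdot>\<^sub>v unit_vec n i"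
        using w C assms(6) by (intro delete_coord_eq_0D) auto
      also have "\<dots> = unit_vec n i"
        using wi1 by simp
      finally have "w = unit_vec n i" .
      then show False
        using w assms(7) by simp
    qed
  qed
qed

end
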